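(* Let $\Sigma$ be an $n\times n$ real symmetric positive-definite matrix and $X$ an $n\times p$ real matrix of full column rank, and let $$M=\Sigma^{-1}-\Sigma^{-1}X(X^{*}\Sigma^{-1}X)^{-1}X^{*}\Sigma^{-1}.$$ Let $\mathcal X=\operatorname{im}(X)$, let $U$ be an $n\times(n-p)$ real matrix whose columns form an orthonormal basis of $\mathcal X^{\perp}$, and put $\Sigma_{\mathcal X^{\perp}}=U^{*}\Sigma U$ and $y_{\mathcal X^{\perp}}=U^{*}y$ for $y\in\mathbb R^n$. Consider the likelihood function $$p(y)=\frac{1}{\sqrt{(2\pi)^{n-p}}}\,|\Sigma|^{-1/2}\,|X^{*}\Sigma^{-1}X|^{-1/2}\exp\left(-\tfrac12\,y^{*}My\right).$$ Then $$p(y)=|X^{*}X|^{-1/2}\,\frac{1}{\sqrt{(2\pi)^{n-p}}}\,|M|_{\dagger}^{1/2}\exp\left(-\tfrac12\,y^{*}My\right),$$ and moreover $|M|_{\dagger}=|\Sigma_{\mathcal X^{\perp}}|^{-1}$ and $y^{*}My=y_{\mathcal X^{\perp}}^{*}(\Sigma_{\mathcal X^{\perp}})^{-1}y_{\mathcal X^{\perp}}$. Hence, up to the constant factor $|X^{*}X|^{-1/2}$, $p$ restricted to $\mathcal X^{\perp}$ is, in the coordinates $y_{\mathcal X^{\perp}}$, the density of the $(n-p)$-dimensional normal distribution $\mathcal N(0,\Sigma_{\mathcal X^{\perp}})$.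
   Context: $(\cdot)^{*}$ is the (conjugate) transpose, $|\cdot|$ the determinant, $(\cdot)^{\perp}$ the orthogonal complement. $|\cdot|_{\dagger}$ denotes the pseudo-determinant of a square matrix: the product of its non-zero eigenvalues, with value $1$ for a nilpotent matrix. *)

theory Defs
  imports
    "HOL-Analysis.Lebesgue_Measure"
    "Jordan_Normal_Form.Spectral_Radius"
    "Jordan_Normal_Form.DL_Rank"
begin

no_notation inner (infixl "\<bullet>" 70)

definition spd_mat :: "nat \<Rightarrow> real mat \<Rightarrow> bool" where
  "spd_mat n A \<longleftrightarrow> A \<in> carrier_mat n n \<and> transpose_mat A = A \<and>
     (\<forall>v \<in> carrier_vec n. v \<noteq> 0\<^sub>v n \<longrightarrow> v \<bullet> (A *\<^sub>v v) > 0)"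

text \<open>The inverse of a matrix; unspecified if the matrix is not invertible.\<close>

abbreviation minv :: "real mat \<Rightarrow> real mat" where
  "minv A \<equiv> the (mat_inverse A)"

text \<open>
  The product of the non-zero complex eigenvalues, counted with algebraic multiplicity.
  The non-real eigenvalues of a real matrix come in conjugate pairs of equal multiplicity,
  so the product is real and taking its real part loses nothing.
\<close>

definition pseudo_det :: "real mat \<Rightarrow> real" where
  "pseudo_det A = (let B = map_mat complex_of_real A in
     Re (\<Prod>e \<in> spectrum B - {0}. e ^ Polynomial.order e (char_poly B)))"

definition orthonormal_basis_cols :: "nat \<Rightarrow> real mat \<Rightarrow> real vec set \<Rightarrow> bool" where
  "orthonormal_basis_cols n U W \<longleftrightarrow>
     (\<forall>i < dim_col U. \<forall>j < dim_col U. col U i \<bullet> col U j = (if i = j then 1 else 0)) \<and>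
     vec_space.col_space n U = W"

definition multivariate_normal_density :: "real vec \<Rightarrow> real mat \<Rightarrow> real vec \<Rightarrow> real" where
  "multivariate_normal_density \<mu> S x =
     1 / sqrt ((2 * pi) ^ dim_row S * det S) *
     exp (- 1 / 2 * ((x - \<mu>) \<bullet> (minv S *\<^sub>v (x - \<mu>))))"

text \<open>
  Lebesgue measure on real \<open>k\<close>-space is the \<open>k\<close>-fold product of \<open>lborel\<close>; a point \<open>z\<close> of
  that space is a function on \<open>{..<k}\<close>, and \<open>vec k z\<close> is the corresponding vector.
\<close>

abbreviation lborel_pow :: "nat \<Rightarrow> (nat \<Rightarrow> real) measure" where
  "lborel_pow k \<equiv> \<Pi>\<^sub>M i\<in>{..<k}. lborel"

definition multivariate_normal :: "nat \<Rightarrow> real vec \<Rightarrow> real mat \<Rightarrow> (nat \<Rightarrow> real) measure" where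
  "multivariate_normal k \<mu> S =
     density (lborel_pow k) (\<lambda>z. ennreal (multivariate_normal_density \<mu> S (vec k z)))"

end

(* Concatenating columns, put P = (Sigma U | X) and Q = (U | X). Since U^* X = 0, the products
   Q^* Q, Q^* P and (Sigma^-1 P)^* P are block triangular, and comparing their determinants gives
   |Sigma| |X^* Sigma^-1 X| = |U^* Sigma U| |X^* X|. The matrices M and U (U^* Sigma U)^-1 U^* agree
   on the columns of P, so they are equal; conjugating by Q turns M into the block diagonal matrix
   diag((U^* Sigma U)^-1, 0), from which the pseudo-determinant is read off. *)

theory Submission
  imports Defs
begin

no_notation inner (infix "\<bullet>" 70)

section \<open>Associativity, inverses and full column rank\<close>

text \<open>The carrier premises of \<open>assoc_mult_mat\<close> mention dimensions that do not
  occur in its conclusion; with dimension equations instead, the rule can be used for conditional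
  rewriting.\<close>

lemma mult_mat_assoc_dim:
  fixes A B C :: "'a :: semiring_0 mat"
  assumes "dim_col A = dim_row B" "dim_col B = dim_row C"
  shows "A * B * C = A * (B * C)"
  using assms by (intro assoc_mult_mat[of A "dim_row A" "dim_row B" B "dim_row C" C "dim_col C"]) auto

lemma mult_mat_vec_assoc_dim:
  fixes A B :: "'a :: semiring_0 mat"
  assumes "dim_col A = dim_row B" "dim_col B = dim_vec v"
  shows "A * B *\<^sub>v v = A *\<^sub>v (B *\<^sub>v v)"
  using assms by (intro assoc_mult_mat_vec[of A "dim_row A" "dim_row B" B "dim_vec v"]) auto

lemma minv:
  assumes A: "A \<in> carrier_mat n n" and "det A \<noteq> 0"
  shows "minv A \<in> carrier_mat n n" "A * minv A = 1\<^sub>m n" "minv A * A = 1\<^sub>m n"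
proof -
  \<comment> \<open>The result \<open>None\<close> would mean that A is not a unit of the matrix
    ring, but a nonzero determinant makes it one. The \<open>()\<close> merely fills the extension
    slot of the ring record.\<close>
  have "mat_inverse A \<noteq> None"
    using mat_inverse(1)[OF A, of "()"] det_non_zero_imp_unit[OF assms, of "()"] by blast
  then have "mat_inverse A = Some (minv A)" by auto
  from mat_inverse(2)[OF A this]
  show "minv A \<in> carrier_mat n n" "A * minv A = 1\<^sub>m n" "minv A * A = 1\<^sub>m n" by auto
qed

lemma det_minv:
  assumes A: "A \<in> carrier_mat n n" and nz: "det A \<noteq> 0"
  shows "det (minv A) = inverse (det A)"
proof -
  have "det A * det (minv A) = 1"
    using det_mult[OF A minv(1)[OF assms]] minv(2)[OF assms] by simp
  then show ?thesis using nz by (simp add: field_simps)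
qed

text \<open>The rank is the size of a maximal independent subset of the set of columns, and a
  repeated column would leave that set with fewer than p elements.\<close>

lemma full_rank_imp_distinct_cols:
  fixes X :: "'a :: field mat"
  assumes X: "X \<in> carrier_mat n p" and rank: "vec_space.rank n X = p"
  shows "distinct (cols X)"
proof -
  interpret vec_space "TYPE('a)" n .
  obtain T where T: "maximal T (\<lambda>T. T \<subseteq> set (cols X) \<and> lin_indpt T)"
    using maximal_exists_superset[of "set (cols X)" "\<lambda>T. T \<subseteq> set (cols X) \<and> lin_indpt T" "{}"]
    by (auto simp: finite_lin_indpt2)
  have "p = card T" using rank_card_indpt[OF X T] rank by simp
  also have "card T \<le> card (set (cols X))"
    using T by (intro card_mono) (auto simp: maximal_def)
  finally have "length (cols X) \<le> card (set (cols X))" using X by simp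
  then show ?thesis
    using card_length[of "cols X"] by (intro card_distinct) simp
qed

text \<open>Guarantees that the truncated subtraction \<open>n - p\<close> is a true
  difference.\<close>

lemma full_rank_imp_le:
  fixes X :: "'a :: field mat"
  assumes X: "X \<in> carrier_mat n p" and rank: "vec_space.rank n X = p"
  shows "p \<le> n"
proof -
  interpret vec_space "TYPE('a)" n .
  note dist = full_rank_imp_distinct_cols[OF assms]
  have "set (cols X) \<subseteq> carrier_vec n" using cols_dim[of X] X by auto
  with li_le_dim(2)[OF fin_dim _ full_rank_lin_indpt[OF X rank dist]]
  show ?thesis using X distinct_card[OF dist] dim_is_n by simp
qed

text \<open>A nonzero kernel vector is a linear dependence among the columns. Distinctness matters
  because \<open>lin_indpt\<close> speaks of the set of columns, where a repetition is
  invisible.\<close>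

lemma full_rank_imp_inj:
  fixes X :: "'a :: field mat"
  assumes X: "X \<in> carrier_mat n p" and rank: "vec_space.rank n X = p"
    and v: "v \<in> carrier_vec p" "X *\<^sub>v v = 0\<^sub>v n"
  shows "v = 0\<^sub>v p"
proof -
  interpret vec_space "TYPE('a)" n .
  note dist = full_rank_imp_distinct_cols[OF X rank]
  show ?thesis
    using full_rank_lin_indpt[OF X rank dist] lin_depI[OF X v(1) _ v(2) dist] by blast
qed

subsection \<open>Positive definite matrices\<close>

lemma spd_matD:
  assumes "spd_mat n A"
  shows "A \<in> carrier_mat n n" "transpose_mat A = A"
    "v \<in> carrier_vec n \<Longrightarrow> v \<noteq> 0\<^sub>v n \<Longrightarrow> v \<bullet> (A *\<^sub>v v) > 0"
  using assms by (auto simp: spd_mat_def)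

lemma spd_one: "spd_mat n (1\<^sub>m n)"
  using conjugate_square_greater_0_vec[where 'a = real] by (auto simp: spd_mat_def)

text \<open>Far to the right q is positive, so a negative value at 0 would force a positive root by
  the intermediate value theorem.\<close>

lemma monic_no_nonneg_root_imp_pos:
  fixes q :: "real poly"
  assumes lc: "lead_coeff q > 0" and nr: "\<And>x. x \<ge> 0 \<Longrightarrow> poly q x \<noteq> 0"
  shows "poly q 0 > 0"
proof (rule ccontr)
  assume "\<not> poly q 0 > 0"
  then have neg: "poly q 0 < 0" using nr[of 0] by simp
  obtain b where b: "\<And>x. x \<ge> b \<Longrightarrow> poly q x \<ge> lead_coeff q"
    using poly_pinfty_gt_lc[OF lc] by blast
  have "poly q (max b 1) > 0" using b[of "max b 1"] lc by simp
  then obtain x where "x > 0" "poly q x = 0"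
    using poly_IVT_pos[of 0 "max b 1" q] neg by fastforce
  with nr[of x] show False by simp
qed

text \<open>The characteristic polynomial of \<open>-A\<close> is monic and, as \<open>A + x I\<close> is invertible for
  \<open>x \<ge> 0\<close>, it has no root there; its value at \<open>0\<close> is \<open>det A\<close>.\<close>

lemma spd_det_pos:
  assumes spd: "spd_mat n A"
  shows "det A > 0"
proof -
  note A = spd_matD(1)[OF spd]
  have uA: "- A \<in> carrier_mat n n" using A by simp
  let ?q = "char_poly (- A)"
  have ev: "poly ?q x = det (x \<cdot>\<^sub>m 1\<^sub>m n + A)" for x
  proof -
    have "- char_matrix (- A) x = x \<cdot>\<^sub>m 1\<^sub>m n + A"
      by (rule eq_matI) (use A in \<open>auto simp: char_matrix_def\<close>)
    then show ?thesis using char_poly_matrix[OF uA, of x] by simp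
  qed
  have "poly ?q x \<noteq> 0" if x: "x \<ge> 0" for x
  proof
    assume "poly ?q x = 0"
    then have "det (x \<cdot>\<^sub>m 1\<^sub>m n + A) = 0" by (simp add: ev)
    \<comment> \<open>A kernel vector v, paired with its image, would give x |v|^2 + v \<bullet> Av
      = 0, against definiteness of A and x \<ge> 0.\<close>
    then obtain v where v: "v \<in> carrier_vec n" "v \<noteq> 0\<^sub>v n"
      and eq: "(x \<cdot>\<^sub>m 1\<^sub>m n + A) *\<^sub>v v = 0\<^sub>v n"
      using det_0_iff_vec_prod_zero_field[of "x \<cdot>\<^sub>m 1\<^sub>m n + A" n] A by auto
    have "(x \<cdot>\<^sub>m 1\<^sub>m n + A) *\<^sub>v v = x \<cdot>\<^sub>v v + A *\<^sub>v v"
      using A v by (subst add_mult_distrib_mat_vec[of _ n n]) (auto intro!: eq_vecI)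
    then have "x \<cdot>\<^sub>v v + A *\<^sub>v v = 0\<^sub>v n" using eq by simp
    then have "0 = v \<bullet> (x \<cdot>\<^sub>v v + A *\<^sub>v v)" using v(1) by simp
    also have "\<dots> = x * (v \<bullet> v) + v \<bullet> (A *\<^sub>v v)"
      using A v by (subst scalar_prod_add_distrib[of _ n]) auto
    also have "\<dots> > 0"
      using x spd_matD(3)[OF spd v] spd_matD(3)[OF spd_one v] v(1)
      by (intro add_nonneg_pos mult_nonneg_nonneg) auto
    finally show False by simp
  qed
  moreover have "lead_coeff ?q > 0" using degree_monic_char_poly[OF uA] by simp
  ultimately have "poly ?q 0 > 0" by (intro monic_no_nonneg_root_imp_pos)
  moreover have "0 \<cdot>\<^sub>m 1\<^sub>m n + A = A" by (rule eq_matI) (use A in auto)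
  ultimately show ?thesis by (simp add: ev)
qed

text \<open>The new quadratic form at v is the form of A at Bv, and Bv is nonzero by injectivity.
  This is the source of definiteness for \<open>S\<close>, \<open>G\<close>, the Gram matrix of X
  and inverses.\<close>

lemma spd_congruence:
  assumes spd: "spd_mat n A" and B: "B \<in> carrier_mat n k"
    and inj: "\<And>v. v \<in> carrier_vec k \<Longrightarrow> B *\<^sub>v v = 0\<^sub>v n \<Longrightarrow> v = 0\<^sub>v k"
  shows "spd_mat k (transpose_mat B * A * B)"
proof -
  note A = spd_matD(1)[OF spd]
  have "transpose_mat (transpose_mat B * A * B) = transpose_mat B * (A * B)"
    using A B spd_matD(2)[OF spd] by (subst transpose_mult[of _ k n _ k], simp_all)
      (subst transpose_mult[of _ k n _ n], simp_all)
  moreover have "v \<bullet> (transpose_mat B * A * B *\<^sub>v v) > 0"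
    if v: "v \<in> carrier_vec k" "v \<noteq> 0\<^sub>v k" for v
  proof -
    have Bv: "B *\<^sub>v v \<in> carrier_vec n" "B *\<^sub>v v \<noteq> 0\<^sub>v n" using B v inj by auto
    have "v \<bullet> (transpose_mat B * A * B *\<^sub>v v) = v \<bullet> (transpose_mat B *\<^sub>v (A *\<^sub>v (B *\<^sub>v v)))"
      using A B v by (simp add: mult_mat_vec_assoc_dim)
    also have "\<dots> = (B *\<^sub>v v) \<bullet> (A *\<^sub>v (B *\<^sub>v v))"
      using transpose_vec_mult_scalar[of "transpose_mat B" k n "A *\<^sub>v (B *\<^sub>v v)" v] A B v by simp
    finally show ?thesis using spd_matD(3)[OF spd Bv] by simp
  qed
  ultimately show ?thesis using A B by (auto simp: spd_mat_def mult_mat_assoc_dim)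
qed

text \<open>The inverse is a congruence of A by the inverse itself:
  \<open>minv A = transpose_mat (minv A) * A * minv A\<close>.\<close>

lemma spd_minv:
  assumes spd: "spd_mat n A"
  shows "spd_mat n (minv A)"
proof -
  note A = spd_matD(1,2)[OF spd]
  have "det A \<noteq> 0" using spd_det_pos[OF spd] by simp
  note inv = minv[OF A(1) this]
  have "transpose_mat (minv A) * A = 1\<^sub>m n"
    using transpose_mult[OF A(1) inv(1)] inv A by simp
  then have "transpose_mat (minv A) * A * minv A = minv A" using inv by simp
  \<comment> \<open>Bracketed the other way, the same triple product is
    \<open>transpose_mat (minv A)\<close>.\<close>
  then have "transpose_mat (minv A) = minv A"
    using inv A by (simp add: mult_mat_assoc_dim)
  moreover have "spd_mat n (transpose_mat (minv A) * A * minv A)"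
  proof (rule spd_congruence[OF spd inv(1)])
    fix v assume v: "v \<in> carrier_vec n" "minv A *\<^sub>v v = 0\<^sub>v n"
    have "v = A * minv A *\<^sub>v v" using v inv by simp
    also have "\<dots> = A *\<^sub>v 0\<^sub>v n" unfolding v(2)[symmetric]
      using A inv(1) v(1) by (intro mult_mat_vec_assoc_dim) auto
    also have "\<dots> = 0\<^sub>v n" using A by (intro eq_vecI) auto
    finally show "v = 0\<^sub>v n" .
  qed
  ultimately show ?thesis using \<open>transpose_mat (minv A) * A * minv A = minv A\<close> by simp
qed

subsection \<open>Pseudo-determinants\<close>

lemma char_poly_four_block_lower_left_zero:
  fixes A :: "'a :: idom mat"
  assumes A: "A \<in> carrier_mat n n" and B: "B \<in> carrier_mat n m" and D: "D \<in> carrier_mat m m"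
  shows "char_poly (four_block_mat A B (0\<^sub>m m n) D) = char_poly A * char_poly D"
proof -
  have "char_poly_matrix (four_block_mat A B (0\<^sub>m m n) D) =
    four_block_mat (char_poly_matrix A) (map_mat (\<lambda>a. [:-a:]) B) (0\<^sub>m m n) (char_poly_matrix D)"
    by (rule eq_matI) (use A B D in \<open>auto simp: char_poly_matrix_def\<close>)
  then show ?thesis
    using A B D by (simp add: char_poly_def det_four_block_mat_lower_left_zero[of _ n _ m])
qed

lemma char_poly_zero_mat: "char_poly (0\<^sub>m m m :: 'a :: comm_ring_1 mat) = [:0, 1:] ^ m"
proof -
  have "diag_mat (0\<^sub>m m m :: 'a mat) = replicate m 0"
    by (rule nth_equalityI) (auto simp: diag_mat_def)
  then show ?thesis by (subst char_poly_upper_triangular[of _ m]) auto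
qed

text \<open>Both sides, multiplied by (-1)^k, are the value at 0 of the characteristic polynomial:
  once from its factorisation over the complex numbers, once from its definition as a
  determinant.\<close>

lemma prod_roots_eq_det:
  fixes B :: "complex mat"
  assumes B: "B \<in> carrier_mat k k"
  shows "(\<Prod>z | poly (char_poly B) z = 0. z ^ Polynomial.order z (char_poly B)) = det B"
proof -
  let ?q = "char_poly B" and ?R = "{z. poly (char_poly B) z = 0}"
  have lc: "lead_coeff ?q = 1" and deg: "degree ?q = k"
    using degree_monic_char_poly[OF B] by auto
  have dec: "(\<Prod>z\<in>?R. [:-z, 1:] ^ Polynomial.order z ?q) = ?q"
    using complex_poly_decompose[of ?q] lc by simp
  \<comment> \<open>Comparing degrees shows that the multiplicities add up to k, which collects the
    signs into (-1)^k.\<close>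
  have "degree (\<Prod>z\<in>?R. [:-z, 1:] ^ Polynomial.order z ?q) = (\<Sum>z\<in>?R. Polynomial.order z ?q)"
    by (subst degree_prod_eq_sum_degree) (auto simp: degree_power_eq)
  then have sum: "(\<Sum>z\<in>?R. Polynomial.order z ?q) = k" using dec deg by simp
  have "poly ?q 0 = (\<Prod>z\<in>?R. (-1) ^ Polynomial.order z ?q * z ^ Polynomial.order z ?q)"
    by (subst dec[symmetric]) (simp add: poly_prod power_mult_distrib[symmetric] del: power_mult_distrib)
  also have "\<dots> = (-1) ^ k * (\<Prod>z\<in>?R. z ^ Polynomial.order z ?q)"
    by (simp add: prod.distrib sum flip: power_sum)
  finally have 1: "poly ?q 0 = (-1) ^ k * (\<Prod>z\<in>?R. z ^ Polynomial.order z ?q)" .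
  have "- char_matrix B 0 = (-1) \<cdot>\<^sub>m B"
    by (rule eq_matI) (use B in \<open>auto simp: char_matrix_def\<close>)
  then have "poly ?q 0 = (-1) ^ k * det B"
    using char_poly_matrix[OF B, of 0] B by (simp add: det_smult)
  with 1 show ?thesis by simp
qed

text \<open>The factor \<open>[:0, 1:] ^ m\<close> only contributes the root 0, and 0 is no root of
  the other factor because \<open>det B\<close> is nonzero. So A and B have the same nonzero
  eigenvalues with the same multiplicities, and for B these are all the eigenvalues.\<close>

lemma pseudo_det_eqI:
  assumes A: "A \<in> carrier_mat n n" and B: "B \<in> carrier_mat k k" and nz: "det B \<noteq> 0"
    and cp: "char_poly A = char_poly B * [:0, 1:] ^ m"
  shows "pseudo_det A = det B"
proof -
  let ?A = "map_mat complex_of_real A" and ?B = "map_mat complex_of_real B"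
  let ?q = "char_poly ?B"
  have cA: "?A \<in> carrier_mat n n" and cB: "?B \<in> carrier_mat k k" using A B by auto
  interpret hom: map_poly_comm_ring_hom complex_of_real ..
  have cp': "char_poly ?A = ?q * [:0, 1:] ^ m"
    unfolding of_real_hom.char_poly_hom[OF A] of_real_hom.char_poly_hom[OF B] cp
    by (simp add: hom.hom_mult hom.hom_power)
  have det: "det ?B = complex_of_real (det B)" by (rule of_real_hom.hom_det)
  have q0: "?q \<noteq> 0" using degree_monic_char_poly[OF cB] by auto
  have "poly ?q 0 = det (- char_matrix ?B 0)" by (rule char_poly_matrix[OF cB])
  also have "- char_matrix ?B 0 = (-1) \<cdot>\<^sub>m ?B"
    by (rule eq_matI) (use B in \<open>auto simp: char_matrix_def\<close>)
  finally have nr: "poly ?q 0 \<noteq> 0" using nz det cB by (simp add: det_smult)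
  have spec: "spectrum ?A - {0} = {z. poly ?q z = 0}"
    unfolding spectrum_root_char_poly[OF cA] cp' using nr by (auto simp: poly_power)
  have ord: "Polynomial.order z (char_poly ?A) = Polynomial.order z ?q" if "z \<noteq> 0" for z
  proof -
    have "Polynomial.order z ([:0, 1:] ^ m) = 0"
      using that by (intro order_0I) (simp add: poly_power)
    then show ?thesis unfolding cp' using q0 by (subst order_mult) auto
  qed
  have "(\<Prod>e\<in>spectrum ?A - {0}. e ^ Polynomial.order e (char_poly ?A)) =
      (\<Prod>z | poly ?q z = 0. z ^ Polynomial.order z ?q)"
    unfolding spec
  proof (intro prod.cong refl)
    fix z assume "z \<in> {z. poly ?q z = 0}"
    then have "z \<noteq> 0" using nr by auto
    then show "z ^ Polynomial.order z (char_poly ?A) = z ^ Polynomial.order z ?q"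
      using ord by metis
  qed
  also have "\<dots> = det ?B" by (rule prod_roots_eq_det[OF cB])
  finally show ?thesis by (simp add: pseudo_det_def Let_def det)
qed

subsection \<open>Horizontal concatenation\<close>

text \<open>Lower blocks with no rows make the concatenation a four-block matrix, so that the block
  multiplication and transposition rules apply.\<close>

definition hconcat :: "'a :: zero mat \<Rightarrow> 'a mat \<Rightarrow> 'a mat" where
  "hconcat A B = four_block_mat A B (0\<^sub>m 0 (dim_col A)) (0\<^sub>m 0 (dim_col B))"

lemma hconcat_carrier [simp]:
  "A \<in> carrier_mat n k \<Longrightarrow> B \<in> carrier_mat n p \<Longrightarrow> hconcat A B \<in> carrier_mat n (k + p)"
  by (auto simp: hconcat_def)

lemma transpose_hconcat_mult_hconcat:
  fixes A B C D :: "'a :: comm_semiring_0 mat"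
  assumes "A \<in> carrier_mat n k" "B \<in> carrier_mat n p" "C \<in> carrier_mat n k'" "D \<in> carrier_mat n p'"
  shows "transpose_mat (hconcat A B) * hconcat C D =
    four_block_mat (transpose_mat A * C) (transpose_mat A * D)
      (transpose_mat B * C) (transpose_mat B * D)"
proof -
  \<comment> \<open>Each entry of such a product is an empty sum.\<close>
  have z: "0\<^sub>m r 0 * 0\<^sub>m 0 c = (0\<^sub>m r c :: 'a mat)" for r c
    by (rule eq_matI) (auto simp: scalar_prod_def)
  have "transpose_mat (hconcat A B) = four_block_mat (transpose_mat A) (0\<^sub>m k 0) (transpose_mat B) (0\<^sub>m p 0)"
    unfolding hconcat_def using assms by (subst transpose_four_block_mat[of _ n k _ p _ 0]) auto
  moreover have "hconcat C D = four_block_mat C D (0\<^sub>m 0 k') (0\<^sub>m 0 p')"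
    using assms by (simp add: hconcat_def)
  ultimately show ?thesis
    using assms by (simp add: mult_four_block_mat[of _ k n _ 0 _ p _ _ k' _ p'] z)
qed

lemma mult_hconcat:
  fixes A B E :: "'a :: comm_semiring_0 mat"
  assumes "A \<in> carrier_mat n k" "B \<in> carrier_mat n p" "E \<in> carrier_mat m n"
  shows "E * hconcat A B = hconcat (E * A) (E * B)"
proof (rule eq_matI)
  fix i j assume ij: "i < dim_row (hconcat (E * A) (E * B))" "j < dim_col (hconcat (E * A) (E * B))"
  have "col (hconcat A B) j = (if j < k then col A j else col B (j - k))"
    using assms ij by (intro eq_vecI) (auto simp: hconcat_def)
  then show "(E * hconcat A B) $$ (i, j) = hconcat (E * A) (E * B) $$ (i, j)"
    using assms ij by (auto simp: hconcat_def)
qed (use assms in \<open>auto simp: hconcat_def\<close>)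

lemma hconcat_mult_block_diag:
  fixes A B C D :: "'a :: comm_semiring_0 mat"
  assumes "A \<in> carrier_mat n k" "B \<in> carrier_mat n p" "C \<in> carrier_mat k k" "D \<in> carrier_mat p p"
  shows "hconcat A B * four_block_mat C (0\<^sub>m k p) (0\<^sub>m p k) D = hconcat (A * C) (B * D)"
proof -
  have "hconcat A B = four_block_mat A B (0\<^sub>m 0 k) (0\<^sub>m 0 p)"
    using assms by (simp add: hconcat_def)
  also have "\<dots> * four_block_mat C (0\<^sub>m k p) (0\<^sub>m p k) D =
      four_block_mat (A * C) (B * D) (0\<^sub>m 0 k) (0\<^sub>m 0 p)"
    using assms by (subst mult_four_block_mat[of _ n k _ p _ 0 _ _ k _ p]) (auto simp: right_mult_zero_mat intro!: cong_four_block_mat)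
  finally show ?thesis using assms by (simp add: hconcat_def)
qed

subsection \<open>The precision matrix of the restricted likelihood\<close>

text \<open>The hypotheses in the form used for computing: full rank as injectivity, the basis of
  the orthogonal complement as two matrix equations, and the dimensions without subtraction.\<close>

locale restricted_likelihood =
  fixes n k p :: nat and \<Sigma> X U S G M :: "real mat"
  assumes n: "n = k + p"
    and spd: "spd_mat n \<Sigma>"
    and X: "X \<in> carrier_mat n p"
    and X_inj: "\<And>v. v \<in> carrier_vec p \<Longrightarrow> X *\<^sub>v v = 0\<^sub>v n \<Longrightarrow> v = 0\<^sub>v p"
    and U: "U \<in> carrier_mat n k"
    and UU: "transpose_mat U * U = 1\<^sub>m k"
    and UX: "transpose_mat U * X = 0\<^sub>m k p"
    and S_def: "S = transpose_mat U * \<Sigma> * U"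
    and G_def: "G = transpose_mat X * minv \<Sigma> * X"
    and M_def: "M = minv \<Sigma> - minv \<Sigma> * X * minv G * transpose_mat X * minv \<Sigma>"
begin

no_notation inner (infix "\<bullet>" 70)

lemmas Sig = spd_matD(1)[OF spd]

lemma det_Sig: "det \<Sigma> > 0" by (rule spd_det_pos[OF spd])

lemmas iSig = minv[OF Sig det_Sig[THEN less_imp_neq, symmetric]]

lemma XU: "transpose_mat X * U = 0\<^sub>m p k"
  using arg_cong[OF UX, of transpose_mat] transpose_mult[of "transpose_mat U" k n X p] X U by simp

text \<open>U is injective because \<open>transpose_mat U\<close> is a left inverse, so S is a
  congruence of \<Sigma>.\<close>

lemma spd_S: "spd_mat k S"
  unfolding S_def
proof (rule spd_congruence[OF spd U])
  fix v assume v: "v \<in> carrier_vec k" "U *\<^sub>v v = 0\<^sub>v n"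
  have "v = transpose_mat U * U *\<^sub>v v" using v UU by simp
  also have "\<dots> = transpose_mat U *\<^sub>v (U *\<^sub>v v)"
    using U v(1) by (intro mult_mat_vec_assoc_dim) auto
  also have "\<dots> = 0\<^sub>v k" using U v by auto
  finally show "v = 0\<^sub>v k" .
qed

lemma spd_G: "spd_mat p G"
  unfolding G_def by (rule spd_congruence[OF spd_minv[OF spd] X X_inj])

lemma spd_gram: "spd_mat p (transpose_mat X * X)"
  using spd_congruence[OF spd_one X X_inj] X by simp

lemmas S = spd_matD(1)[OF spd_S]
lemmas G = spd_matD(1)[OF spd_G]
lemmas det_S = spd_det_pos[OF spd_S]
lemmas det_G = spd_det_pos[OF spd_G]
lemmas det_gram = spd_det_pos[OF spd_gram]
lemmas iS = minv[OF S det_S[THEN less_imp_neq, symmetric]]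
lemmas iG = minv[OF G det_G[THEN less_imp_neq, symmetric]]

abbreviation "P \<equiv> hconcat (\<Sigma> * U) X"
abbreviation "Q \<equiv> hconcat U X"

lemma P: "P \<in> carrier_mat n n" and Q: "Q \<in> carrier_mat n n"
  using Sig X U by (auto simp: n)

section \<open>The determinant identity relating \<Sigma>, G, S and the Gram matrix of X\<close>

lemma det_Q_sq: "det Q * det Q = det (transpose_mat X * X)"
proof -
  have "transpose_mat Q * Q = four_block_mat (1\<^sub>m k) (0\<^sub>m k p) (0\<^sub>m p k) (transpose_mat X * X)"
    using transpose_hconcat_mult_hconcat[OF U X U X] by (simp add: UU UX XU)
  then have "det (transpose_mat Q * Q) = det (transpose_mat X * X)"
    using X by (simp add: det_four_block_mat_lower_left_zero[of _ k _ p])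
  then show ?thesis using Q by (simp add: det_mult[of _ n] det_transpose[of _ n])
qed

lemma det_Q_P: "det Q * det P = det S * det (transpose_mat X * X)"
proof -
  have "transpose_mat Q * P =
      four_block_mat S (0\<^sub>m k p) (transpose_mat X * (\<Sigma> * U)) (transpose_mat X * X)"
    using transpose_hconcat_mult_hconcat[OF U X mult_carrier_mat[OF Sig U] X] U Sig
    by (simp add: UX S_def mult_mat_assoc_dim)
  then have "det (transpose_mat Q * P) = det S * det (transpose_mat X * X)"
    using X U Sig S by (simp add: det_four_block_mat_upper_right_zero[of _ k _ p])
  then show ?thesis using P Q by (simp add: det_mult[of _ n] det_transpose[of _ n])
qed

lemma det_P_sq: "det P * det P = det \<Sigma> * (det S * det G)"
proof -
  \<comment> \<open>This is \<Sigma>^-1 P. Pairing it with P gives the diagonal blocks S and G; both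
    off-diagonal blocks reduce to U^* X or X^* U and vanish.\<close>
  let ?L = "hconcat U (minv \<Sigma> * X)"
  have L: "?L \<in> carrier_mat n n" using U X iSig by (auto simp: n)
  have tiSig: "transpose_mat (minv \<Sigma>) = minv \<Sigma>" by (rule spd_matD(2)[OF spd_minv[OF spd]])
  have "\<Sigma> * ?L = P"
    using mult_hconcat[OF U mult_carrier_mat[OF iSig(1) X] Sig] Sig X iSig
    by (simp flip: mult_mat_assoc_dim)
  then have 1: "det \<Sigma> * det ?L = det P" using det_mult[OF Sig L] by simp
  have LXU: "transpose_mat (minv \<Sigma> * X) * (\<Sigma> * U) = 0\<^sub>m p k"
  proof -
    have "transpose_mat (minv \<Sigma> * X) * (\<Sigma> * U) = transpose_mat X * (minv \<Sigma> * \<Sigma> * U)"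
      using Sig X U iSig(1) tiSig
      by (simp add: mult_mat_assoc_dim transpose_mult[of _ n n _ p])
    then show ?thesis using iSig U XU by simp
  qed
  have LX: "transpose_mat (minv \<Sigma> * X) * X = G"
    using X iSig(1) tiSig by (simp add: G_def transpose_mult[of _ n n _ p])
  have "transpose_mat ?L * P = four_block_mat S (0\<^sub>m k p) (0\<^sub>m p k) G"
    using transpose_hconcat_mult_hconcat[OF U mult_carrier_mat[OF iSig(1) X] mult_carrier_mat[OF Sig U] X] U Sig
    by (simp add: UX LXU LX S_def mult_mat_assoc_dim)
  then have "det (transpose_mat ?L * P) = det S * det G"
    using S G by (simp add: det_four_block_mat_lower_left_zero[of _ k _ p])
  then have "det ?L * det P = det S * det G"
    using P L by (simp add: det_mult[of _ n] det_transpose[of _ n])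
  then show ?thesis using 1 by (metis mult.assoc)
qed

text \<open>Squaring the relation for det Q det P allows both auxiliary determinants to be
  eliminated through their squares; the positive common factor then cancels.\<close>

lemma det_Sig_det_G: "det \<Sigma> * det G = det S * det (transpose_mat X * X)"
proof -
  let ?s = "det S" and ?x = "det (transpose_mat X * X)"
  have "(?s * ?x) * (?s * ?x) = (det Q * det Q) * (det P * det P)"
    unfolding det_Q_P[symmetric] by simp
  also have "\<dots> = (?s * ?x) * (det \<Sigma> * det G)" unfolding det_Q_sq det_P_sq by simp
  finally show ?thesis using det_S det_gram by simp
qed

section \<open>Factorisation and pseudo-determinant of M\<close>

lemma M_carrier: "M \<in> carrier_mat n n"
  unfolding M_def using iSig(1) iG(1) X by auto

text \<open>Multiplying by X completes a factor G next to \<open>minv G\<close>, so the subtracted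
  term collapses to the first one.\<close>

lemma M_X: "M * X = 0\<^sub>m n p"
proof -
  have "M * X = minv \<Sigma> * X - minv \<Sigma> * X * minv G * transpose_mat X * minv \<Sigma> * X"
    unfolding M_def using iSig(1) iG(1) X by (subst minus_mult_distrib_mat[of _ n n]) auto
  also have "minv \<Sigma> * X * minv G * transpose_mat X * minv \<Sigma> * X = minv \<Sigma> * X * (minv G * G)"
    using iSig(1) iG(1) X by (simp add: G_def mult_mat_assoc_dim)
  finally show ?thesis using iSig(1) iG X by simp
qed

text \<open>Here \<Sigma> cancels against \<open>minv \<Sigma>\<close> in both terms, and the second
  then contains X^* U = 0.\<close>

lemma M_Sig_U: "M * (\<Sigma> * U) = U"
proof -
  have "M * (\<Sigma> * U) = minv \<Sigma> * (\<Sigma> * U) - minv \<Sigma> * X * minv G * transpose_mat X * minv \<Sigma> * (\<Sigma> * U)"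
    unfolding M_def using iSig(1) iG(1) X Sig U by (subst minus_mult_distrib_mat[of _ n n]) auto
  also have "minv \<Sigma> * (\<Sigma> * U) = (minv \<Sigma> * \<Sigma>) * U"
    using iSig(1) Sig U by (simp add: mult_mat_assoc_dim)
  also have "\<dots> = U" using iSig U by simp
  also have "minv \<Sigma> * X * minv G * transpose_mat X * minv \<Sigma> * (\<Sigma> * U) =
      minv \<Sigma> * X * minv G * (transpose_mat X * ((minv \<Sigma> * \<Sigma>) * U))"
    using iSig(1) Sig U X iG(1) by (simp add: mult_mat_assoc_dim)
  also have "\<dots> = minv \<Sigma> * X * minv G * 0\<^sub>m p k" using iSig U XU by simp
  also have "minv \<Sigma> * X * minv G * 0\<^sub>m p k = 0\<^sub>m n k"
    using iSig(1) iG(1) X by (intro right_mult_zero_mat) auto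
  also have "U - 0\<^sub>m n k = U" using U by (intro eq_matI) auto
  finally show ?thesis .
qed

text \<open>Both sides agree on the columns of \<open>P\<close>, which span the whole space.\<close>

lemma M_eq: "M = U * minv S * transpose_mat U"
proof -
  let ?N = "U * minv S * transpose_mat U"
  have N: "?N \<in> carrier_mat n n" using U iS(1) by auto
  have "?N * X = U * minv S * (transpose_mat U * X)"
    using U X iS(1) by (simp add: mult_mat_assoc_dim)
  then have NX: "?N * X = 0\<^sub>m n p" using U X iS(1) by (simp add: UX)
  have "?N * (\<Sigma> * U) = U * (minv S * S)"
    using U Sig iS(1) by (simp add: S_def mult_mat_assoc_dim)
  then have NU: "?N * (\<Sigma> * U) = U" using U iS by simp
  have SU: "\<Sigma> * U \<in> carrier_mat n k" using Sig U by simp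
  have "M * P = hconcat U (0\<^sub>m n p)"
    using mult_hconcat[OF SU X M_carrier] by (simp only: M_X M_Sig_U)
  also have "\<dots> = ?N * P"
    using mult_hconcat[OF SU X N] by (simp only: NX NU)
  finally have eq: "M * P = ?N * P" .
  \<comment> \<open>The square of det P is a product of three positive determinants, so P can be
    cancelled on the right.\<close>
  have "det P \<noteq> 0" using det_P_sq det_Sig det_S det_G by auto
  note iP = minv[OF P this]
  have "M = M * (P * minv P)" using iP M_carrier by simp
  also have "\<dots> = M * P * minv P" by (rule assoc_mult_mat[OF M_carrier P iP(1), symmetric])
  also have "\<dots> = ?N * (P * minv P)" unfolding eq by (rule assoc_mult_mat[OF N P iP(1)])
  also have "\<dots> = ?N" unfolding iP(2) by (rule right_mult_one_mat[OF N])
  finally show ?thesis .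
qed

lemma pseudo_det_M: "pseudo_det M = inverse (det S)"
proof -
  let ?D = "four_block_mat (minv S) (0\<^sub>m k p) (0\<^sub>m p k) (0\<^sub>m p p)"
  have D: "?D \<in> carrier_mat n n" using iS(1) by (auto simp: n)
  have dQ: "det Q \<noteq> 0" using det_Q_sq det_gram by auto
  note iQ = minv[OF Q dQ]
  have "M * U = U * minv S * (transpose_mat U * U)"
    using U iS(1) by (simp add: M_eq mult_mat_assoc_dim)
  then have MU: "M * U = U * minv S" using U iS(1) by (simp add: UU)
  \<comment> \<open>M sends U to \<open>U * minv S\<close> and X to 0, which is the block diagonal
    action of \<open>?D\<close> on the columns of Q.\<close>
  have "M * Q = Q * ?D"
    using mult_hconcat[OF U X M_carrier] hconcat_mult_block_diag[OF U X iS(1), of "0\<^sub>m p p"] X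
    by (simp add: MU M_X)
  then have "Q * ?D * minv Q = M * (Q * minv Q)"
    using assoc_mult_mat[OF M_carrier Q iQ(1)] by simp
  then have "M = Q * ?D * minv Q" using iQ M_carrier by simp
  then have "similar_mat M ?D"
    using Q D iQ M_carrier by (intro similar_matI[of _ _ Q "minv Q" n]) auto
  \<comment> \<open>The zero block of size p supplies the power of the indeterminate.\<close>
  then have "char_poly M = char_poly (minv S) * [:0, 1:] ^ p"
    using iS(1) by (simp add: char_poly_similar char_poly_four_block_lower_left_zero[of _ k _ p] char_poly_zero_mat)
  then have "pseudo_det M = det (minv S)"
    using det_S by (intro pseudo_det_eqI[OF M_carrier iS(1), of p]) (simp_all add: det_minv[OF S])
  then show ?thesis using det_S by (simp add: det_minv[OF S])
qed

section \<open>Quadratic form, normalising constant and normal density\<close>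

lemma quad_form_M:
  assumes y: "y \<in> carrier_vec n"
  shows "y \<bullet> (M *\<^sub>v y) = (transpose_mat U *\<^sub>v y) \<bullet> (minv S *\<^sub>v (transpose_mat U *\<^sub>v y))"
proof -
  have "y \<bullet> (M *\<^sub>v y) = y \<bullet> (U *\<^sub>v (minv S *\<^sub>v (transpose_mat U *\<^sub>v y)))"
    using U iS(1) y by (simp add: M_eq mult_mat_vec_assoc_dim)
  then show ?thesis
    using transpose_vec_mult_scalar[OF U, of "minv S *\<^sub>v (transpose_mat U *\<^sub>v y)" y] U iS(1) y by simp
qed

text \<open>The power -1/2 of \<open>det_Sig_det_G\<close>; positivity of the determinants lets the
  power distribute over the products.\<close>

lemma normalising_constant:
  "det \<Sigma> powr (- 1 / 2) * det G powr (- 1 / 2) =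
    det (transpose_mat X * X) powr (- 1 / 2) * det S powr (- 1 / 2)"
  using det_Sig_det_G det_Sig det_G det_S det_gram
  by (simp add: mult.commute flip: powr_mult)

lemma mvn_density_S:
  assumes z: "z \<in> carrier_vec k"
  shows "multivariate_normal_density (0\<^sub>v k) S z =
    1 / sqrt ((2 * pi) ^ k) * det S powr (- 1 / 2) * exp (- 1 / 2 * (z \<bullet> (minv S *\<^sub>v z)))"
  using z S det_S
  by (simp add: multivariate_normal_density_def real_sqrt_mult powr_minus powr_half_sqrt field_simps)

end

section \<open>From the rank and basis hypotheses to the normal density\<close>

theorem mainTheorem7:
  fixes n p :: nat
    and \<Sigma> X M U S :: "real mat"
    and \<X> \<X>perp :: "real vec set"
    and lik :: "real vec \<Rightarrow> real"
  assumes Sigma: "spd_mat n \<Sigma>"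
    and X: "X \<in> carrier_mat n p"
    and X_rank: "vec_space.rank n X = p"
    and M: "M = minv \<Sigma> - minv \<Sigma> * X * minv (transpose_mat X * minv \<Sigma> * X) * transpose_mat X * minv \<Sigma>"
    and im_X: "\<X> = vec_space.col_space n X"
    and im_X_perp: "\<X>perp = vec_module.orthogonal_complement n \<X>"
    and U: "U \<in> carrier_mat n (n - p)"
    and U_basis: "orthonormal_basis_cols n U \<X>perp"
    and S: "S = transpose_mat U * \<Sigma> * U"
    and lik: "\<forall>y \<in> carrier_vec n. lik y =
      1 / sqrt ((2 * pi) ^ (n - p)) * det \<Sigma> powr (- 1 / 2) *
      det (transpose_mat X * minv \<Sigma> * X) powr (- 1 / 2) *
      exp (- 1 / 2 * (y \<bullet> (M *\<^sub>v y)))"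
  shows "(\<forall>y \<in> carrier_vec n. lik y =
            det (transpose_mat X * X) powr (- 1 / 2) *
            (1 / sqrt ((2 * pi) ^ (n - p))) * pseudo_det M powr (1 / 2) *
            exp (- 1 / 2 * (y \<bullet> (M *\<^sub>v y)))) \<and>
         pseudo_det M = inverse (det S) \<and>
         (\<forall>y \<in> carrier_vec n.
            y \<bullet> (M *\<^sub>v y) = (transpose_mat U *\<^sub>v y) \<bullet> (minv S *\<^sub>v (transpose_mat U *\<^sub>v y))) \<and>
         spd_mat (n - p) S \<and>
         (\<forall>y \<in> \<X>perp. lik y =
            det (transpose_mat X * X) powr (- 1 / 2) *
            multivariate_normal_density (0\<^sub>v (n - p)) S (transpose_mat U *\<^sub>v y)) \<and>
         density (lborel_pow (n - p))
            (\<lambda>z. ennreal (lik (U *\<^sub>v vec (n - p) z) / det (transpose_mat X * X) powr (- 1 / 2))) =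
            multivariate_normal (n - p) (0\<^sub>v (n - p)) S"
proof -
  define k where "k = n - p"
  define G where "G = transpose_mat X * minv \<Sigma> * X"
  have U': "U \<in> carrier_mat n k" using U by (simp add: k_def)
  have UU: "transpose_mat U * U = 1\<^sub>m k"
    by (rule eq_matI) (use U' U_basis in \<open>auto simp: orthonormal_basis_cols_def\<close>)
  have perp: "x \<bullet> y = 0" if "x \<in> \<X>perp" "y \<in> \<X>" for x y
    using that unfolding im_X_perp vec_module.orthogonal_complement_def by auto
  have perp_carrier: "\<X>perp \<subseteq> carrier_vec n"
    unfolding im_X_perp vec_module.orthogonal_complement_def by auto
  have col_in: "col A i \<in> vec_space.col_space n A" if "A \<in> carrier_mat n m" "i < m"
    for A :: "real mat" and m i
  proof -
    interpret vec_space "TYPE(real)" n .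
    have "set (cols A) \<subseteq> carrier_vec n" using cols_dim[of A] that by auto
    moreover have "col A i \<in> set (cols A)" using that by (auto simp: cols_def)
    ultimately show ?thesis unfolding col_space_def using in_own_span by auto
  qed
  have "vec_space.col_space n U = \<X>perp" using U_basis by (simp add: orthonormal_basis_cols_def)
  \<comment> \<open>Columns of U lie in \<open>\<X>perp\<close> and columns of X in
    \<open>\<X>\<close>.\<close>
  then have "col U i \<bullet> col X j = 0" if "i < k" "j < p" for i j
    using col_in[OF U'] col_in[OF X] perp that by (simp add: im_X)
  then have UX: "transpose_mat U * X = 0\<^sub>m k p"
    using U' X by (intro eq_matI) auto
  have n: "n = k + p" using full_rank_imp_le[OF X X_rank] by (simp add: k_def)
  have M': "M = minv \<Sigma> - minv \<Sigma> * X * minv G * transpose_mat X * minv \<Sigma>"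
    using M by (simp add: G_def)
  interpret rl: restricted_likelihood n k p \<Sigma> X U S G M
    by unfold_locales (fact n Sigma X full_rank_imp_inj[OF X X_rank] U' UU UX S G_def M')+
  let ?c = "1 / sqrt ((2 * pi) ^ k)" and ?x = "det (transpose_mat X * X) powr (- 1 / 2)"
  have lik': "lik y = ?x * (?c * det S powr (- 1 / 2) * exp (- 1 / 2 * (y \<bullet> (M *\<^sub>v y))))"
    if "y \<in> carrier_vec n" for y
  proof -
    have "lik y = ?c * (det \<Sigma> powr (- 1 / 2) * det G powr (- 1 / 2)) * exp (- 1 / 2 * (y \<bullet> (M *\<^sub>v y)))"
      using lik that by (simp add: k_def G_def)
    then show ?thesis unfolding rl.normalising_constant by (simp add: mult_ac)
  qed
  have powr: "inverse (det S) powr (1 / 2) = det S powr (- 1 / 2)"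
    using rl.det_S by (simp add: powr_minus inverse_powr)
  have "lik y = ?x * ?c * pseudo_det M powr (1 / 2) * exp (- 1 / 2 * (y \<bullet> (M *\<^sub>v y)))"
    if "y \<in> carrier_vec n" for y
    unfolding lik'[OF that] rl.pseudo_det_M powr by simp
  \<comment> \<open>This holds on all of the n-dimensional space, since the likelihood depends on y
    only through U^* y; the claim on \<open>\<X>perp\<close> is a restriction of it.\<close>
  moreover have mvn: "lik y = ?x * multivariate_normal_density (0\<^sub>v k) S (transpose_mat U *\<^sub>v y)"
    if "y \<in> carrier_vec n" for y
  proof -
    have "transpose_mat U *\<^sub>v y \<in> carrier_vec k" using U' that by auto
    then show ?thesis using lik'[OF that] by (simp add: rl.mvn_density_S rl.quad_form_M[OF that])
  qed
  \<comment> \<open>The point with coordinates z is Uz, because U^* U = 1. Division by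
    \<open>?x\<close> is legitimate as the Gram determinant is positive, and the pointwise equality
    of densities makes the measures equal.\<close>
  moreover have "lik (U *\<^sub>v vec k z) / ?x = multivariate_normal_density (0\<^sub>v k) S (vec k z)" for z
  proof -
    have "transpose_mat U *\<^sub>v (U *\<^sub>v vec k z) = transpose_mat U * U *\<^sub>v vec k z"
      using U' by (intro mult_mat_vec_assoc_dim[symmetric]) auto
    then have "transpose_mat U *\<^sub>v (U *\<^sub>v vec k z) = vec k z" by (simp add: UU)
    moreover have "U *\<^sub>v vec k z \<in> carrier_vec n" using U' by simp
    ultimately show ?thesis using mvn[of "U *\<^sub>v vec k z"] rl.det_gram by simp
  qed
  then have "density (lborel_pow k) (\<lambda>z. ennreal (lik (U *\<^sub>v vec k z) / ?x)) =
      multivariate_normal k (0\<^sub>v k) S"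
    by (simp only: multivariate_normal_def)
  ultimately show ?thesis
    using rl.pseudo_det_M rl.quad_form_M rl.spd_S perp_carrier unfolding k_def by blast
qed

end
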